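(* For every prime $p>3$, $$\sum_{k=1}^{p-1}(-1)^k k^2 D_kD_{k-1}\equiv -\frac56\,p \pmod{p^2}$$ and $$\sum_{k=1}^{p}(-1)^k(4k^2+2k-1)D_{k-1}s_k\equiv -4p\pmod{p^2}.$$
   Context: For $n\in\mathbb{N}=\{0,1,2,\dots\}$, $D_n$ is the $n$-th central Delannoy number, $D_n=\sum_{k=0}^{n}\binom{n}{k}\binom{n+k}{k}$. For an integer $n\ge 1$, $s_n$ is the $n$-th little Schröder number, $s_n=\sum_{k=1}^{n}\frac1n\binom{n}{k}\binom{n}{k-1}2^{n-k}$. Congruences modulo $p^2$ between rational numbers whose denominators are prime to $p$ are understood in the ring of $p$-adic integers (equivalently, in the localization $\mathbb{Z}_{(p)}$). *)

theory Defs
  imports Complex_Main "HOL-Computational_Algebra.Primes"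
begin

definition central_delannoy :: "nat \<Rightarrow> nat" where
  "central_delannoy n = (\<Sum>k=0..n. (n choose k) * ((n + k) choose k))"

text \<open>
  The little Schroeder numbers are integers, but the defining formula is kept literally,
  with the factor $1/n$, so the values are taken in the rationals.
  Only the values at \<open>n \<ge> 1\<close> are meaningful.
\<close>

definition little_schroeder :: "nat \<Rightarrow> rat" where
  "little_schroeder n =
     (\<Sum>k=1..n. 1 / of_nat n * of_nat (n choose k) * of_nat (n choose (k - 1)) * 2 ^ (n - k))"

text \<open>
  The localization of the integers at the prime ideal \<open>(p)\<close>. For \<open>b = 0\<close> the condition
  on the denominator fails, so no division by zero occurs.
\<close>

definition int_localization :: "nat \<Rightarrow> rat set" where
  "int_localization p = {of_int a / of_int b | a b. \<not> int p dvd b}"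

text \<open>Congruence modulo \<open>m\<close> in the localization at \<open>p\<close>; both sides must lie in that ring.\<close>

definition local_cong :: "nat \<Rightarrow> rat \<Rightarrow> rat \<Rightarrow> rat \<Rightarrow> bool" where
  "local_cong p m x y \<longleftrightarrow>
     x \<in> int_localization p \<and> y \<in> int_localization p \<and>
     (\<exists>z \<in> int_localization p. x - y = m * z)"

end

theory Submission
  imports Defs
begin

text \<open>
  Both alternating sums telescope, so that for every \<open>n \<ge> 1\<close> they have a closed form. Writing
  \<open>D\<close> for the central Delannoy numbers and \<open>s\<close> for the little Schroeder numbers,

  \<open>36 (-1)^n \<Sum>\<^sub>k\<^sub>\<le>\<^sub>n (-1)^k k^2 D_k D_(k-1) = 3 n^2 (D_n^2 - D_(n-1)^2) + (18 n^2 + 10 n) D_n D_(n-1)\<close>,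

  \<open>9 (-1)^n \<Sum>\<^sub>k\<^sub>\<le>\<^sub>n (-1)^k (4 k^2 + 2 k - 1) D_(k-1) s_k
      = 2 n D_(n-1)^2 + 9 n (2 n + 1) D_(n-1) s_n + 4 n (n + 1)^2 s_n^2\<close>

  (\<open>sum_delannoy_products\<close> and \<open>sum_delannoy_schroeder_products\<close>). For \<open>n = p\<close> the right-hand sides
  carry a visible factor \<open>p\<close>, so modulo \<open>p^2\<close> only the residues modulo \<open>p\<close> of \<open>D_p\<close>, \<open>D_(p-1)\<close> and
  \<open>s_p\<close> matter. The first two are \<open>3\<close> and \<open>1\<close>, since almost all summands in the definition of \<open>D\<close> are
  divisible by \<open>p\<close>, and the second relation below then gives \<open>s_p \<equiv> 2\<close>.
  The first sum becomes \<open>-36 S \<equiv> 30 p\<close> (the term \<open>k = p\<close> that is missing in it is divisible by \<open>p^2\<close>) and the second one \<open>-9 S \<equiv> p (2 + 18 + 16) = 36 p\<close>.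

  The closed forms follow by induction from two linear relations. One is the three-term recurrence
  \<open>(n + 2) D_(n+2) = 3 (2 n + 3) D_(n+1) - (n + 1) D_n\<close>, the recurrence of the Legendre polynomials
  at the argument \<open>3\<close>; the other, \<open>4 (n + 1) s_n = 3 D_n - D_(n-1)\<close> for \<open>n \<ge> 1\<close>, is the formula
  for the derivative of a Legendre polynomial at \<open>3\<close>. Indeed, with
  \<open>F n k = (n choose k) (n + k choose k)\<close> (\<open>delannoy_summand\<close>), the polynomial
  \<open>\<Sum>k. F n k x^k\<close> is the \<open>n\<close>-th Legendre polynomial at \<open>1 + 2 x\<close>; its value at \<open>x = 1\<close> is \<open>D_n\<close>, and its derivative \<open>\<Sum>k. k F n k\<close> there is
  \<open>n (n + 1) s_n\<close> by Vandermonde's convolution. Both Legendre relations hold coefficientwise in \<open>x\<close>,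
  where they are rational identities between neighbouring values of \<open>F\<close>.
\<close>

section \<open>The coefficients of the Legendre polynomials\<close>

definition delannoy_summand :: "nat \<Rightarrow> nat \<Rightarrow> rat" where
  "delannoy_summand n k = of_nat (n choose k) * of_nat ((n + k) choose k)"

lemma delannoy_summand_eq_0: "n < k \<Longrightarrow> delannoy_summand n k = 0"
  by (simp add: delannoy_summand_def binomial_eq_0)

lemma delannoy_summand_0 [simp]: "delannoy_summand n 0 = 1"
  by (simp add: delannoy_summand_def)

lemma central_delannoy_eq_sum:
  assumes "n \<le> N"
  shows "of_nat (central_delannoy n) = (\<Sum>k\<le>N. delannoy_summand n k)"
proof -
  have "of_nat (central_delannoy n) = (\<Sum>k\<le>n. delannoy_summand n k)"
    by (simp add: central_delannoy_def delannoy_summand_def atLeast0AtMost)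
  also have "\<dots> = (\<Sum>k\<le>N. delannoy_summand n k)"
    using assms by (intro sum.mono_neutral_left) (auto simp: delannoy_summand_eq_0)
  finally show ?thesis .
qed

lemma delannoy_summand_Suc_right:
  "(of_nat k + 1) ^ 2 * delannoy_summand n (Suc k)
     = (of_nat n - of_nat k) * (of_nat n + of_nat k + 1) * delannoy_summand n k"
proof (cases "k \<le> n")
  case True
  have "Suc k * (n choose Suc k) = (n - k) * (n choose k)"
    using binomial_absorption[of k n] binomial_absorb_comp[of n k] by simp
  hence *: "(of_nat k + 1) * of_nat (n choose Suc k) = (of_nat n - of_nat k) * (of_nat (n choose k) :: rat)"
    using True by (metis of_nat_Suc of_nat_diff of_nat_mult add.commute)
  have "Suc k * (n + Suc k choose Suc k) = (n + k + 1) * (n + k choose k)"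
    using Suc_times_binomial_eq[of "n + k" k] by (simp add: mult.commute)
  hence **: "(of_nat k + 1) * of_nat (n + Suc k choose Suc k)
       = (of_nat n + of_nat k + 1) * (of_nat (n + k choose k) :: rat)"
    by (metis of_nat_Suc of_nat_add of_nat_mult add.commute of_nat_1)
  show ?thesis
    using arg_cong2[OF * **, of "(*)"] by (simp add: delannoy_summand_def power2_eq_square algebra_simps)
qed (simp add: not_le delannoy_summand_eq_0)

lemma delannoy_summand_Suc_left:
  "(of_nat n + 1 - of_nat k) * delannoy_summand (Suc n) k
     = (of_nat n + of_nat k + 1) * delannoy_summand n k"
proof (cases "k \<le> Suc n")
  case True
  have "(Suc n - k) * (Suc n choose k) = Suc n * (n choose k)"
    using binomial_absorb_comp[of "Suc n" k] by simp
  hence *: "(of_nat n + 1 - of_nat k) * of_nat (Suc n choose k) = (of_nat n + 1) * (of_nat (n choose k) :: rat)"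
    using True by (metis of_nat_Suc of_nat_diff of_nat_mult add.commute)
  have "Suc n * (Suc n + k choose k) = (n + k + 1) * (n + k choose k)"
    using binomial_absorb_comp[of "Suc n + k" k] by simp
  hence **: "(of_nat n + 1) * of_nat (Suc n + k choose k)
       = (of_nat n + of_nat k + 1) * (of_nat (n + k choose k) :: rat)"
    by (metis of_nat_Suc of_nat_add of_nat_mult add.commute of_nat_1)
  have "(of_nat n + 1 - of_nat k) * delannoy_summand (Suc n) k
      = ((of_nat n + 1) * of_nat (Suc n + k choose k)) * of_nat (n choose k)"
    by (simp add: delannoy_summand_def * mult.assoc[symmetric])
  thus ?thesis unfolding ** by (simp add: delannoy_summand_def mult_ac)
qed (simp add: not_le delannoy_summand_eq_0)

text \<open>
  Every value of \<open>F\<close> needed below is a rational multiple of \<open>F (n + 1) k\<close>. The factor \<open>(k + 1)^2\<close>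
  never vanishes and can be cancelled later. A factor such as \<open>n - k\<close> could not be cancelled at the
  border of the triangle \<open>k \<le> n\<close>, so the ratios are combined until only \<open>(k + 1)^2\<close> is on the left.
\<close>
lemma delannoy_summand_neighbours:
  defines "f \<equiv> (\<lambda>n k. delannoy_summand n k)"
  shows "(of_nat k + 1) ^ 2 * f (n + 2) (Suc k)
      = (of_nat n + of_nat k + 2) * (of_nat n + of_nat k + 3) * f (n + 1) k"
    and "(of_nat k + 1) ^ 2 * f (n + 1) (Suc k)
      = (of_nat n + 1 - of_nat k) * (of_nat n + of_nat k + 2) * f (n + 1) k"
    and "(of_nat k + 1) ^ 2 * f n (Suc k)
      = (of_nat n - of_nat k) * (of_nat n + 1 - of_nat k) * f (n + 1) k"
proof -
  have "(of_nat k + 1) ^ 2 * f (n + 2) (Suc k)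
      = (of_nat n + 2 - of_nat k) * (of_nat n + of_nat k + 3) * f (n + 2) k"
    using delannoy_summand_Suc_right[of k "n + 2"] by (simp add: f_def add_ac)
  moreover have "(of_nat n + 2 - of_nat k) * f (n + 2) k = (of_nat n + of_nat k + 2) * f (n + 1) k"
    using delannoy_summand_Suc_left[of "n + 1" k] by (simp add: f_def add_ac)
  ultimately show "(of_nat k + 1) ^ 2 * f (n + 2) (Suc k)
      = (of_nat n + of_nat k + 2) * (of_nat n + of_nat k + 3) * f (n + 1) k"
    by algebra
  show "(of_nat k + 1) ^ 2 * f (n + 1) (Suc k)
      = (of_nat n + 1 - of_nat k) * (of_nat n + of_nat k + 2) * f (n + 1) k"
    using delannoy_summand_Suc_right[of k "n + 1"] by (simp add: f_def algebra_simps)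
  have "(of_nat k + 1) ^ 2 * f n (Suc k)
      = (of_nat n - of_nat k) * ((of_nat n + of_nat k + 1) * f n k)"
    using delannoy_summand_Suc_right[of k n] by (simp add: f_def)
  thus "(of_nat k + 1) ^ 2 * f n (Suc k)
      = (of_nat n - of_nat k) * (of_nat n + 1 - of_nat k) * f (n + 1) k"
    using delannoy_summand_Suc_left[of n k] by (simp add: f_def)
qed

text \<open>
  The coefficient of \<open>x^(k+1)\<close> in the Legendre recurrence
  \<open>(n + 2) P_(n+2) + (n + 1) P_n = (2 n + 3) (1 + 2 x) P_(n+1)\<close>, where \<open>P_n = \<Sum>k. F n k x^k\<close>.
\<close>
lemma delannoy_summand_three_term:
  "(of_nat n + 2) * delannoy_summand (n + 2) (Suc k) + (of_nat n + 1) * delannoy_summand n (Suc k)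
     = (2 * of_nat n + 3) * (delannoy_summand (n + 1) (Suc k) + 2 * delannoy_summand (n + 1) k)"
  (is "?l = ?r")
proof -
  note nb = delannoy_summand_neighbours[where n = n and k = k]
  have "(of_nat k + 1) ^ 2 * ?l
      = (of_nat n + 2) * ((of_nat k + 1) ^ 2 * delannoy_summand (n + 2) (Suc k))
        + (of_nat n + 1) * ((of_nat k + 1) ^ 2 * delannoy_summand n (Suc k))"
    by (simp only: distrib_left mult_ac)
  also have "\<dots> = (2 * of_nat n + 3) * ((of_nat k + 1) ^ 2 * delannoy_summand (n + 1) (Suc k)
        + 2 * (of_nat k + 1) ^ 2 * delannoy_summand (n + 1) k)"
    unfolding nb by algebra
  also have "\<dots> = (of_nat k + 1) ^ 2 * ?r"
    by (simp only: distrib_left mult_ac)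
  finally show ?thesis
    by (simp add: add_eq_0_iff flip: of_nat_Suc)
qed

text \<open>
  The coefficient of \<open>x^(k+1)\<close> in
  \<open>2 (1 + x) x P_(n+1)' = (n + 1) ((1 + 2 x) P_(n+1) - P_n)\<close>, which is the classical
  \<open>(t^2 - 1) P_m'(t) = m (t P_m(t) - P_(m-1)(t))\<close> for \<open>t = 1 + 2 x\<close> and \<open>m = n + 1\<close>.
\<close>
lemma delannoy_summand_derivative:
  "2 * (of_nat k + 1) * delannoy_summand (n + 1) (Suc k) + 2 * of_nat k * delannoy_summand (n + 1) k
     = (of_nat n + 1) * (delannoy_summand (n + 1) (Suc k) + 2 * delannoy_summand (n + 1) k
          - delannoy_summand n (Suc k))"
  (is "?l = ?r")
proof -
  note nb = delannoy_summand_neighbours[where n = n and k = k]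
  have "(of_nat k + 1) ^ 2 * ?l
      = 2 * (of_nat k + 1) * ((of_nat k + 1) ^ 2 * delannoy_summand (n + 1) (Suc k))
        + 2 * of_nat k * (of_nat k + 1) ^ 2 * delannoy_summand (n + 1) k"
    by (simp only: distrib_left mult_ac)
  also have "\<dots> = (of_nat n + 1) * ((of_nat k + 1) ^ 2 * delannoy_summand (n + 1) (Suc k)
        + 2 * (of_nat k + 1) ^ 2 * delannoy_summand (n + 1) k
        - (of_nat k + 1) ^ 2 * delannoy_summand n (Suc k))"
    unfolding nb by algebra
  also have "\<dots> = (of_nat k + 1) ^ 2 * ?r"
    by (simp only: distrib_left right_diff_distrib mult_ac)
  finally show ?thesis
    by (simp add: add_eq_0_iff flip: of_nat_Suc)
qed

section \<open>Linear relations between Delannoy and Schroeder numbers\<close>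

lemma central_delannoy_eq_shifted_sum:
  assumes "n \<le> Suc N"
  shows "of_nat (central_delannoy n) = 1 + (\<Sum>k\<le>N. delannoy_summand n (Suc k))"
  using central_delannoy_eq_sum[OF assms] by (simp add: sum.atMost_Suc_shift del: sum.atMost_Suc)

lemma central_delannoy_recurrence:
  "(of_nat n + 2) * (of_nat (central_delannoy (n + 2)) :: rat)
     = 3 * (2 * of_nat n + 3) * of_nat (central_delannoy (n + 1))
       - (of_nat n + 1) * of_nat (central_delannoy n)"
proof -
  have "(\<Sum>k\<le>n+1. (of_nat n + 2) * delannoy_summand (n + 2) (Suc k)
            + (of_nat n + 1) * delannoy_summand n (Suc k))
      = (\<Sum>k\<le>n+1. (2 * of_nat n + 3)
            * (delannoy_summand (n + 1) (Suc k) + 2 * delannoy_summand (n + 1) k))"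
    by (intro sum.cong refl delannoy_summand_three_term)
  hence "(of_nat n + 2) * (of_nat (central_delannoy (n + 2)) - 1)
          + (of_nat n + 1) * (of_nat (central_delannoy n) - 1)
      = (2 * of_nat n + 3) * ((of_nat (central_delannoy (n + 1)) - 1)
          + 2 * (of_nat (central_delannoy (n + 1)) :: rat))"
    unfolding sum.distrib sum_distrib_left[symmetric]
    using central_delannoy_eq_shifted_sum[of "n + 2" "n + 1"]
      central_delannoy_eq_shifted_sum[of "n + 1" "n + 1"]
      central_delannoy_eq_shifted_sum[of n "n + 1"] central_delannoy_eq_sum[of "n + 1" "n + 1"]
    by simp
  thus ?thesis by algebra
qed

lemma sum_times_delannoy_summand:
  "4 * (\<Sum>k\<le>n+1. of_nat k * delannoy_summand (n + 1) k)
     = (of_nat n + 1) * (3 * of_nat (central_delannoy (n + 1)) - of_nat (central_delannoy n))"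
proof -
  let ?W = "\<Sum>k\<le>n+1. of_nat k * delannoy_summand (n + 1) k"
  have "(\<Sum>k\<le>n+1. 2 * ((of_nat k + 1) * delannoy_summand (n + 1) (Suc k))
            + 2 * (of_nat k * delannoy_summand (n + 1) k))
      = (\<Sum>k\<le>n+1. (of_nat n + 1) * (delannoy_summand (n + 1) (Suc k)
            + 2 * delannoy_summand (n + 1) k - delannoy_summand n (Suc k)))"
    by (intro sum.cong refl) (simp only: delannoy_summand_derivative mult.assoc[symmetric])
  moreover have "?W = (\<Sum>k\<le>n+1. (of_nat k + 1) * delannoy_summand (n + 1) (Suc k))"
  proof -
    have "?W = (\<Sum>k\<le>Suc (n + 1). of_nat k * delannoy_summand (n + 1) k)"
      by (simp add: delannoy_summand_eq_0)
    also have "\<dots> = (\<Sum>k\<le>n+1. (of_nat k + 1) * delannoy_summand (n + 1) (Suc k))"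
      by (subst sum.atMost_Suc_shift) (simp add: add.commute)
    finally show ?thesis .
  qed
  moreover have "(\<Sum>k\<le>n+1. delannoy_summand (n + 1) (Suc k)) = of_nat (central_delannoy (n + 1)) - 1"
    "(\<Sum>k\<le>n+1. delannoy_summand n (Suc k)) = of_nat (central_delannoy n) - 1"
    "(\<Sum>k\<le>n+1. delannoy_summand (n + 1) k) = of_nat (central_delannoy (n + 1))"
    using central_delannoy_eq_shifted_sum[of "n + 1" "n + 1"]
      central_delannoy_eq_shifted_sum[of n "n + 1"] central_delannoy_eq_sum[of "n + 1" "n + 1"]
    by (simp_all del: sum.atMost_Suc)
  ultimately have "2 * ?W + 2 * ?W = (of_nat n + 1)
      * ((of_nat (central_delannoy (n + 1)) - 1) + 2 * of_nat (central_delannoy (n + 1))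
         - (of_nat (central_delannoy n) - 1))"
    unfolding sum.distrib sum_subtractf sum_distrib_left[symmetric]
    by (simp only:)
  thus ?thesis by algebra
qed

lemma sum_choose_mult_choose:
  assumes "j \<le> n"
  shows "(\<Sum>k\<le>n. (n choose k) * (k choose j)) = (n choose j) * 2 ^ (n - j)"
proof -
  have "(\<Sum>k\<le>n. (n choose k) * (k choose j)) = (\<Sum>k=j..n. (n choose k) * (k choose j))"
    by (intro sum.mono_neutral_right) auto
  also have "\<dots> = (\<Sum>k=j..n. (n choose j) * ((n - j) choose (k - j)))"
    by (intro sum.cong) (auto simp: choose_mult)
  also have "\<dots> = (n choose j) * (\<Sum>i\<le>n-j. (n - j) choose i)"
    unfolding sum_distrib_left
    by (rule sum.reindex_bij_witness[of _ "\<lambda>i. i + j" "\<lambda>k. k - j"]) (use assms in auto)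
  finally show ?thesis by (simp add: choose_row_sum)
qed

lemma sum_choose_pred_mult_choose:
  assumes "k \<le> n"
  shows "(\<Sum>j=1..n. (n choose (j - 1)) * (k choose j)) = (n + k) choose (n + 1)"
proof -
  have "(n + k) choose (n + 1) = (\<Sum>j\<le>n+1. (k choose j) * (n choose (n + 1 - j)))"
    by (simp only: vandermonde add.commute)
  also have "\<dots> = (\<Sum>j=1..n. (k choose j) * (n choose (n + 1 - j)))"
  proof (intro sum.mono_neutral_right ballI)
    fix j assume "j \<in> {..n + 1} - {1..n}"
    hence "j = 0 \<or> j = n + 1" by auto
    thus "(k choose j) * (n choose (n + 1 - j)) = 0" using assms by auto
  qed auto
  also have "\<dots> = (\<Sum>j=1..n. (n choose (j - 1)) * (k choose j))"
  proof (intro sum.cong refl)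
    fix j assume "j \<in> {1..n}"
    hence "n choose (n + 1 - j) = n choose (j - 1)"
      using binomial_symmetric[of "j - 1" n] by (cases j) auto
    thus "(k choose j) * (n choose (n + 1 - j)) = (n choose (j - 1)) * (k choose j)" by simp
  qed
  finally show ?thesis ..
qed

text \<open>
  Expanding \<open>(n choose j) 2^(n-j)\<close> as \<open>\<Sum>k. (n choose k) (k choose j)\<close> and exchanging the sums leaves
  a Vandermonde convolution over \<open>j\<close>. The powers of \<open>2\<close> disappear, and what remains is a sum over
  the coefficients \<open>F n k\<close> up to the factor \<open>k / (n + 1)\<close>.
\<close>
lemma little_schroeder_eq_sum:
  assumes "n \<ge> 1"
  shows "of_nat n * little_schroeder n = of_nat (\<Sum>k\<le>n. (n choose k) * ((n + k) choose (n + 1)))"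
proof -
  have "(\<Sum>j=1..n. (n choose j) * (n choose (j - 1)) * 2 ^ (n - j))
      = (\<Sum>j=1..n. \<Sum>k\<le>n. (n choose k) * ((n choose (j - 1)) * (k choose j)))"
  proof (intro sum.cong refl)
    fix j assume "j \<in> {1..n}"
    hence "(n choose j) * (n choose (j - 1)) * 2 ^ (n - j)
        = (n choose (j - 1)) * (\<Sum>k\<le>n. (n choose k) * (k choose j))"
      by (simp add: sum_choose_mult_choose)
    thus "(n choose j) * (n choose (j - 1)) * 2 ^ (n - j)
        = (\<Sum>k\<le>n. (n choose k) * ((n choose (j - 1)) * (k choose j)))"
      by (simp add: sum_distrib_left mult_ac)
  qed
  also have "\<dots> = (\<Sum>k\<le>n. (n choose k) * (\<Sum>j=1..n. (n choose (j - 1)) * (k choose j)))"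
    by (subst sum.swap) (simp add: sum_distrib_left)
  also have "\<dots> = (\<Sum>k\<le>n. (n choose k) * ((n + k) choose (n + 1)))"
    by (intro sum.cong refl) (simp add: sum_choose_pred_mult_choose del: One_nat_def)
  finally have "(\<Sum>j=1..n. (n choose j) * (n choose (j - 1)) * 2 ^ (n - j))
      = (\<Sum>k\<le>n. (n choose k) * ((n + k) choose (n + 1)))" .
  moreover have "of_nat n * little_schroeder n
      = of_nat (\<Sum>j=1..n. (n choose j) * (n choose (j - 1)) * 2 ^ (n - j))"
    using assms by (simp add: little_schroeder_def sum_distrib_left)
  ultimately show ?thesis by simp
qed

lemma little_schroeder_conv_central_delannoy:
  "4 * (of_nat n + 2) * little_schroeder (n + 1)
     = 3 * of_nat (central_delannoy (n + 1)) - of_nat (central_delannoy n)"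
proof -
  have "(n + 2) * ((n + 1 + k) choose (n + 2)) = k * ((n + 1 + k) choose k)" for k
  proof (cases k)
    case (Suc j)
    have "(n + 1 + k) choose (n + 2) = (n + 1 + k) choose j"
      using binomial_symmetric[of "n + 2" "n + 1 + k"] Suc by simp
    moreover have "(n + 2) * ((n + 1 + k) choose j) = k * ((n + 1 + k) choose k)"
      using binomial_absorption[of j "n + 1 + k"] binomial_absorb_comp[of "n + 1 + k" j] Suc by simp
    ultimately show ?thesis by simp
  qed simp
  hence "of_nat (n + 2) * of_nat (((n + 1) choose k) * ((n + 1 + k) choose (n + 2)))
      = of_nat k * delannoy_summand (n + 1) k" for k
    unfolding delannoy_summand_def of_nat_mult[symmetric] by (metis mult.left_commute)
  hence "of_nat (n + 2) * of_nat (\<Sum>k\<le>n+1. ((n + 1) choose k) * ((n + 1 + k) choose (n + 2)))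
      = (\<Sum>k\<le>n+1. of_nat k * delannoy_summand (n + 1) k)"
    by (simp only: of_nat_sum sum_distrib_left)
  moreover have "of_nat (n + 1) * little_schroeder (n + 1)
      = of_nat (\<Sum>k\<le>n+1. ((n + 1) choose k) * ((n + 1 + k) choose (n + 2)))"
    using little_schroeder_eq_sum[of "n + 1"] by (simp only: add.assoc one_add_one le_add2)
  ultimately have "(of_nat n + 2) * (of_nat (n + 1) * little_schroeder (n + 1))
      = (\<Sum>k\<le>n+1. of_nat k * delannoy_summand (n + 1) k)"
    by (simp only: of_nat_add of_nat_numeral)
  hence "4 * ((of_nat n + 2) * (of_nat (n + 1) * little_schroeder (n + 1))) = (of_nat n + 1)
      * (3 * of_nat (central_delannoy (n + 1)) - of_nat (central_delannoy n))"
    using sum_times_delannoy_summand[of n] by simp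
  hence "(of_nat n + 1) * (4 * (of_nat n + 2) * little_schroeder (n + 1)) = (of_nat n + 1)
      * (3 * of_nat (central_delannoy (n + 1)) - of_nat (central_delannoy n))"
    by (simp add: algebra_simps)
  thus ?thesis by (simp flip: of_nat_Suc)
qed

lemma little_schroeder_conv_central_delannoy':
  "4 * (of_nat n + 1) * little_schroeder (n + 1)
     = of_nat (central_delannoy (n + 2)) - 3 * of_nat (central_delannoy (n + 1))"
proof -
  have "(of_nat n + 2) * (4 * (of_nat n + 1) * little_schroeder (n + 1))
      = (of_nat n + 2) * (of_nat (central_delannoy (n + 2)) - 3 * of_nat (central_delannoy (n + 1)))"
    using central_delannoy_recurrence[of n] little_schroeder_conv_central_delannoy[of n] by algebra
  moreover have "(of_nat n + 2 :: rat) \<noteq> 0"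
    by (metis of_nat_0_eq_iff of_nat_add of_nat_numeral add_is_0 zero_neq_numeral)
  ultimately show ?thesis by simp
qed

lemma little_schroeder_recurrence:
  "(of_nat n + 3) * little_schroeder (n + 2)
     = 2 * of_nat (central_delannoy (n + 1)) + 3 * (of_nat n + 1) * little_schroeder (n + 1)"
  using little_schroeder_conv_central_delannoy[of "n + 1"] little_schroeder_conv_central_delannoy'[of n]
  by (simp add: algebra_simps numeral_2_eq_2)

section \<open>The two sums in closed form\<close>

lemma alternating_sum_closed_form:
  fixes t T :: "nat \<Rightarrow> rat"
  assumes "T 0 = c * t 1" and "\<And>n. T (n + 1) + T n = c * t (n + 2)"
  shows "c * (-1) ^ (n + 1) * (\<Sum>k=1..n+1. (-1) ^ k * t k) = T n"
proof (induction n)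
  case 0
  show ?case using assms(1) by simp
next
  case (Suc n)
  have "c * (-1) ^ (Suc n + 1) * (\<Sum>k=1..Suc n + 1. (-1) ^ k * t k)
      = - (c * (-1) ^ (n + 1) * (\<Sum>k=1..n+1. (-1) ^ k * t k))
        + c * ((-1) ^ (n + 2) * (-1) ^ (n + 2)) * t (n + 2)"
    by (simp add: distrib_left mult_ac)
  also have "\<dots> = T (Suc n)"
    unfolding Suc.IH using assms(2)[of n] by (simp flip: power_mult_distrib add: add_eq_0_iff algebra_simps)
  finally show ?case .
qed

text \<open>
  The recurrence expresses \<open>(n + 1) D_n\<close> through \<open>D_(n+1)\<close> and \<open>(n + 2) D_(n+2)\<close>. Since the right-hand
  side is a quadratic form in \<open>(n + 1) D_n\<close> and \<open>D_(n+1)\<close>, the induction step is a polynomial identity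
  in \<open>D_(n+1)\<close>, \<open>D_(n+2)\<close> and \<open>n\<close>.
\<close>
lemma sum_delannoy_products:
  fixes n :: nat
  defines "d \<equiv> (\<lambda>k. of_nat (central_delannoy k) :: rat)"
  shows "36 * (-1) ^ (n + 1) * (\<Sum>k=1..n+1. (-1) ^ k * of_nat k ^ 2 * d k * d (k - 1))
     = 3 * (of_nat n + 1) ^ 2 * (d (n + 1) ^ 2 - d n ^ 2)
       + (18 * (of_nat n + 1) ^ 2 + 10 * (of_nat n + 1)) * d (n + 1) * d n"
proof -
  define T :: "nat \<Rightarrow> rat" where "T = (\<lambda>n. 3 * (of_nat n + 1) ^ 2 * (d (n + 1) ^ 2 - d n ^ 2)
       + (18 * (of_nat n + 1) ^ 2 + 10 * (of_nat n + 1)) * d (n + 1) * d n)"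
  define t :: "nat \<Rightarrow> rat" where "t = (\<lambda>k. of_nat k ^ 2 * d k * d (k - 1))"
  have "36 * (-1) ^ (n + 1) * (\<Sum>k=1..n+1. (-1) ^ k * t k) = T n"
  proof (rule alternating_sum_closed_form)
    show "T 0 = 36 * t 1" by (simp add: T_def t_def d_def central_delannoy_def)
    fix n
    define N :: rat where "N = of_nat n"
    have fold_d: "of_nat (central_delannoy k) = d k" for k by (simp add: d_def)
    have T1: "T (n + 1) = 3 * (N + 2) ^ 2 * (d (n + 2) ^ 2 - d (n + 1) ^ 2)
       + (18 * (N + 2) ^ 2 + 10 * (N + 2)) * d (n + 2) * d (n + 1)"
      and t2: "t (n + 2) = (N + 2) ^ 2 * d (n + 2) * d (n + 1)"
      by (simp_all add: T_def t_def N_def add_ac)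
    show "T (n + 1) + T n = 36 * t (n + 2)"
      unfolding T1 t2 using central_delannoy_recurrence[of n]
      unfolding T_def fold_d N_def[symmetric]
      by algebra
  qed
  thus ?thesis by (simp add: T_def t_def mult.assoc)
qed

text \<open>
  The coefficient \<open>4 k^2 + 2 k - 1\<close> makes this one telescope: in the induction step, \<open>k = n + 2\<close>,
  the factor of \<open>D_(n+1) s_(n+2)\<close> is \<open>9 (n + 2) (2 n + 5) - 9 (4 k^2 + 2 k - 1) = - 9 (2 n + 3) (n + 3)\<close>,
  and a multiple of \<open>(n + 3) s_(n+2)\<close> can be expressed through \<open>D_(n+1)\<close> and \<open>s_(n+1)\<close> without a
  denominator.
\<close>
lemma sum_delannoy_schroeder_products:
  fixes n :: nat
  defines "d \<equiv> (\<lambda>k. of_nat (central_delannoy k) :: rat)" and "s \<equiv> little_schroeder"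
  shows "9 * (-1) ^ (n + 1)
         * (\<Sum>k=1..n+1. (-1) ^ k * (4 * of_nat k ^ 2 + 2 * of_nat k - 1) * d (k - 1) * s k)
     = 2 * (of_nat n + 1) * d n ^ 2 + 9 * (of_nat n + 1) * (2 * of_nat n + 3) * d n * s (n + 1)
       + 4 * (of_nat n + 1) * (of_nat n + 2) ^ 2 * s (n + 1) ^ 2"
proof -
  define T :: "nat \<Rightarrow> rat" where "T = (\<lambda>n. 2 * (of_nat n + 1) * d n ^ 2
       + 9 * (of_nat n + 1) * (2 * of_nat n + 3) * d n * s (n + 1)
       + 4 * (of_nat n + 1) * (of_nat n + 2) ^ 2 * s (n + 1) ^ 2)"
  define t :: "nat \<Rightarrow> rat"
    where "t = (\<lambda>k. (4 * of_nat k ^ 2 + 2 * of_nat k - 1) * d (k - 1) * s k)"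
  have "9 * (-1) ^ (n + 1) * (\<Sum>k=1..n+1. (-1) ^ k * t k) = T n"
  proof (rule alternating_sum_closed_form)
    show "T 0 = 9 * t 1"
      by (simp add: T_def t_def d_def s_def central_delannoy_def little_schroeder_def)
    fix n
    define N :: rat where "N = of_nat n"
    have fold_d: "of_nat (central_delannoy k) = d k" for k by (simp add: d_def)
    have T1: "T (n + 1) = 2 * (N + 2) * d (n + 1) ^ 2 + 9 * (N + 2) * (2 * N + 5) * d (n + 1) * s (n + 2)
       + 4 * (N + 2) * (N + 3) ^ 2 * s (n + 2) ^ 2"
      and t2: "t (n + 2) = (4 * (N + 2) ^ 2 + 2 * (N + 2) - 1) * d (n + 1) * s (n + 2)"
      by (simp_all add: T_def t_def N_def add_ac)
    show "T (n + 1) + T n = 9 * t (n + 2)"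
      unfolding T1 t2
      using little_schroeder_conv_central_delannoy[of n] little_schroeder_recurrence[of n]
      unfolding T_def fold_d s_def[symmetric] N_def[symmetric]
      by algebra
  qed
  thus ?thesis by (simp add: T_def t_def mult.assoc)
qed


section \<open>Residues of Delannoy numbers modulo a prime\<close>

text \<open>
  Only the summands \<open>k = 0\<close> and \<open>k = p\<close> survive modulo \<open>p\<close>. The latter is \<open>2 p choose p\<close>, which is the
  sum of the squares of the \<open>p choose k\<close> and hence \<open>2\<close> modulo \<open>p\<close>.
\<close>
lemma central_delannoy_cong_prime:
  assumes "prime p"
  shows "\<exists>a. central_delannoy p = 3 + p * a"
proof -
  have p: "p dvd p choose k" if "k \<in> {1..<p}" for k
    using that assms by (intro dvd_choose_prime) auto
  have split: "(\<Sum>k\<le>p. f k) = f 0 + f p + (\<Sum>k=1..<p. f k)" for f :: "nat \<Rightarrow> nat"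
  proof -
    have "{..p} = insert 0 (insert p {1..<p})" using prime_gt_0_nat[OF assms] by auto
    thus ?thesis using prime_gt_0_nat[OF assms] by simp
  qed
  have "p dvd (\<Sum>k=1..<p. (p choose k) ^ 2)"
    using p by (intro dvd_sum) (simp add: power2_eq_square)
  then obtain a where a: "(\<Sum>k=1..<p. (p choose k) ^ 2) = p * a" by (elim dvdE)
  have "(2 * p) choose p = 2 + p * a"
    using choose_square_sum[of p] split[of "\<lambda>k. (p choose k) ^ 2"] a by simp
  moreover have "p dvd (\<Sum>k=1..<p. (p choose k) * ((p + k) choose k))"
    using p by (intro dvd_sum) simp
  then obtain b where b: "(\<Sum>k=1..<p. (p choose k) * ((p + k) choose k)) = p * b" by (elim dvdE)
  have "central_delannoy p = 1 + ((2 * p) choose p) + p * b"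
    using split[of "\<lambda>k. (p choose k) * ((p + k) choose k)"] b
    by (simp add: central_delannoy_def atLeast0AtMost mult_2)
  ultimately have "central_delannoy p = 3 + p * (a + b)" by (simp add: distrib_left)
  thus ?thesis ..
qed

text \<open>
  For \<open>0 < k < p\<close> the numerator of \<open>p - 1 + k choose k\<close> contains the factor \<open>p\<close>, and its denominator
  does not.
\<close>
lemma central_delannoy_pred_cong_prime:
  assumes "prime p"
  shows "\<exists>a. central_delannoy (p - 1) = 1 + p * a"
proof -
  have "p dvd (p - 1 + k) choose k" if k: "k \<in> {1..p-1}" for k
  proof -
    obtain q j where pk: "p = Suc q" "k = Suc j"
      using k assms by (metis Suc_pred atLeastAtMost_iff less_eq_Suc_le prime_gt_0_nat One_nat_def)
    have "k * ((p - 1 + k) choose k) = (p - 1 + k) * ((q + j) choose j)"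
      using Suc_times_binomial_eq[of "q + j" j] by (simp add: pk mult.commute)
    also have "\<dots> = p * ((p - 1 + k) choose j)"
      using binomial_absorb_comp[of "p - 1 + k" j] by (simp add: pk)
    finally have "p dvd k * ((p - 1 + k) choose k)" by simp
    moreover have "\<not> p dvd k" using k by (auto dest: dvd_imp_le)
    ultimately show ?thesis using assms by (simp add: prime_dvd_mult_iff)
  qed
  hence "p dvd (\<Sum>k=1..p-1. ((p - 1) choose k) * ((p - 1 + k) choose k))"
    by (intro dvd_sum) simp
  moreover have "central_delannoy (p - 1)
      = 1 + (\<Sum>k=1..p-1. ((p - 1) choose k) * ((p - 1 + k) choose k))"
    unfolding central_delannoy_def by (subst sum.atLeast_Suc_atMost) simp_all
  ultimately show ?thesis by (auto elim!: dvdE)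
qed

section \<open>Arithmetic in the localization at a prime\<close>

lemma int_localizationI: "\<not> int p dvd b \<Longrightarrow> of_int a / of_int b \<in> int_localization p"
  unfolding int_localization_def by blast

lemma of_int_in_int_localization:
  assumes "prime p"
  shows "of_int a \<in> int_localization p"
  using int_localizationI[of p 1 a] prime_gt_1_nat[OF assms] by simp

lemma of_nat_in_int_localization: "prime p \<Longrightarrow> of_nat n \<in> int_localization p"
  using of_int_in_int_localization[of p "int n"] by simp

lemma numeral_in_int_localization: "prime p \<Longrightarrow> numeral n \<in> int_localization p"
  using of_int_in_int_localization[of p "numeral n"] by simp

lemma int_localization_add:
  assumes "prime p" "x \<in> int_localization p" "y \<in> int_localization p"
  shows "x + y \<in> int_localization p"
proof -
  obtain a b c d where x: "x = of_int a / of_int b" "\<not> int p dvd b"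
    and y: "y = of_int c / of_int d" "\<not> int p dvd d"
    using assms unfolding int_localization_def by auto
  have "b \<noteq> 0" "d \<noteq> 0" using x y by auto
  hence "x + y = of_int (a * d + c * b) / of_int (b * d)"
    by (simp add: x y add_frac_eq)
  moreover have "\<not> int p dvd b * d"
    using x y assms(1) by (simp add: prime_dvd_mult_iff)
  ultimately show ?thesis by (metis int_localizationI)
qed

lemma int_localization_mult:
  assumes "prime p" "x \<in> int_localization p" "y \<in> int_localization p"
  shows "x * y \<in> int_localization p"
proof -
  obtain a b c d where x: "x = of_int a / of_int b" "\<not> int p dvd b"
    and y: "y = of_int c / of_int d" "\<not> int p dvd d"
    using assms unfolding int_localization_def by auto
  have "x * y = of_int (a * c) / of_int (b * d)"
    by (simp add: x y)
  moreover have "\<not> int p dvd b * d"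
    using x y assms(1) by (simp add: prime_dvd_mult_iff)
  ultimately show ?thesis by (metis int_localizationI)
qed

lemma int_localization_power:
  assumes "prime p" "x \<in> int_localization p"
  shows "x ^ n \<in> int_localization p"
  using assms of_nat_in_int_localization[of p 1] by (induction n) (auto intro: int_localization_mult)

lemma int_localization_uminus:
  assumes "prime p" "x \<in> int_localization p"
  shows "- x \<in> int_localization p"
  using int_localization_mult[OF assms(1) of_int_in_int_localization[OF assms(1), of "-1"] assms(2)] by simp

lemma int_localization_diff:
  assumes "prime p" "x \<in> int_localization p" "y \<in> int_localization p"
  shows "x - y \<in> int_localization p"
  using int_localization_add[OF assms(1,2) int_localization_uminus[OF assms(1,3)]] by simp

lemma int_localization_divide_of_nat:
  assumes "prime p" "x \<in> int_localization p" "\<not> p dvd c"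
  shows "x / of_nat c \<in> int_localization p"
proof -
  have "of_int 1 / of_int (int c) \<in> int_localization p"
    using assms(3) by (intro int_localizationI) simp
  from int_localization_mult[OF assms(1,2) this] show ?thesis by simp
qed

lemmas int_localization_intros =
  of_nat_in_int_localization numeral_in_int_localization int_localization_add
  int_localization_mult int_localization_power int_localization_uminus int_localization_diff

lemma local_congI:
  assumes "prime p" "y \<in> int_localization p" "z \<in> int_localization p" "x = y + of_nat m * z"
  shows "local_cong p (of_nat m) x y"
  using assms unfolding local_cong_def
  by (auto intro!: int_localization_intros bexI[of _ z])

section \<open>The congruences\<close>

text \<open>
  Modulo \<open>p\<close>, \<open>4 (p + 1) s_p = 3 D_p - D_(p-1)\<close> becomes \<open>4 s_p \<equiv> 3 * 3 - 1 = 8\<close>, and \<open>4 (p + 1)\<close> is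
  a unit in the localization.
\<close>
lemma little_schroeder_cong_prime:
  assumes "prime p" "p > 3"
  shows "\<exists>v \<in> int_localization p. little_schroeder p = 2 + of_nat p * v"
proof -
  obtain a where a: "central_delannoy p = 3 + p * a" using central_delannoy_cong_prime[OF assms(1)] by blast
  obtain b where b: "central_delannoy (p - 1) = 1 + p * b"
    using central_delannoy_pred_cong_prime[OF assms(1)] by blast
  define v :: rat where "v = (3 * of_nat a - of_nat b - 8) / of_nat (4 * (p + 1))"
  have "\<not> p dvd 2" using assms by (auto dest: dvd_imp_le)
  hence "\<not> p dvd 4" using prime_dvd_mult_iff[OF assms(1), of 2 2] by simp
  moreover have "\<not> p dvd p + 1" using assms dvd_add_right_iff[of p p 1] by simp
  ultimately have "v \<in> int_localization p"
    unfolding v_def using assms(1)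
    by (intro int_localization_divide_of_nat int_localization_intros) (auto simp: prime_dvd_mult_iff)
  moreover have "4 * (of_nat p + 1) * little_schroeder p
      = 3 * (3 + of_nat p * of_nat a) - (1 + of_nat p * of_nat b)"
    using little_schroeder_conv_central_delannoy[of "p - 1"] assms(2) a b
    by (simp add: of_nat_diff add_ac)
  moreover have "v * (4 * (of_nat p + 1)) = 3 * of_nat a - of_nat b - 8"
  proof -
    have nz: "(of_nat (4 * (p + 1)) :: rat) \<noteq> 0" by (simp only: of_nat_eq_0_iff) simp
    have "v * of_nat (4 * (p + 1)) = 3 * of_nat a - of_nat b - 8"
      unfolding v_def by (simp only: times_divide_eq_left nonzero_mult_div_cancel_right[OF nz])
    thus ?thesis by (simp add: add_ac)
  qed
  ultimately have "4 * (of_nat p + 1) * little_schroeder p = 4 * (of_nat p + 1) * (2 + of_nat p * v)"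
    by algebra
  moreover have "(4 * (of_nat p + 1) :: rat) \<noteq> 0" by (simp flip: of_nat_Suc)
  ultimately have "little_schroeder p = 2 + of_nat p * v" by (metis mult_left_cancel)
  with \<open>v \<in> int_localization p\<close> show ?thesis by blast
qed

theorem theorem2:
  fixes p :: nat
  assumes "prime p" and "p > 3"
  shows "local_cong p (of_nat p ^ 2)
           (\<Sum>k=1..p-1. (-1) ^ k * of_nat k ^ 2 *
              of_nat (central_delannoy k) * of_nat (central_delannoy (k - 1)))
           (- (5 / 6) * of_nat p) \<and>
         local_cong p (of_nat p ^ 2)
           (\<Sum>k=1..p. (-1) ^ k * (4 * of_nat k ^ 2 + 2 * of_nat k - 1) *
              of_nat (central_delannoy (k - 1)) * little_schroeder k)
           (- 4 * of_nat p)"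
proof
  define P :: rat where "P = of_nat p"
  define d :: "nat \<Rightarrow> rat" where "d = (\<lambda>k. of_nat (central_delannoy k))"
  obtain a b where "central_delannoy p = 3 + p * a" "central_delannoy (p - 1) = 1 + p * b"
    using central_delannoy_cong_prime central_delannoy_pred_cong_prime assms(1) by meson
  hence d: "d p = 3 + P * of_nat a" "d (p - 1) = 1 + P * of_nat b"
    by (simp_all add: d_def P_def)
  have P_loc: "P \<in> int_localization p"
    using assms(1) by (simp add: P_def of_nat_in_int_localization)
  have p: "p - 1 + 1 = p" "odd p" "of_nat (p - 1) + 1 = P"
    using assms prime_odd_nat[of p] by (auto simp: P_def of_nat_diff)
  have not_dvd: "\<not> p dvd 2" "\<not> p dvd 3" using assms by (auto dest: dvd_imp_le)
  have not_dvd': "\<not> p dvd 36" "\<not> p dvd 9" "\<not> p dvd 6"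
    using not_dvd assms(1) prime_dvd_mult_iff[of p 2 3] prime_dvd_mult_iff[of p 3 3]
      prime_dvd_mult_iff[of p 6 6]
    by auto

  show "local_cong p (of_nat p ^ 2)
           (\<Sum>k=1..p-1. (-1) ^ k * of_nat k ^ 2 *
              of_nat (central_delannoy k) * of_nat (central_delannoy (k - 1)))
           (- (5 / 6) * of_nat p)"
  proof -
    let ?f = "\<lambda>k. (-1) ^ k * of_nat k ^ 2 * d k * d (k - 1)"
    define S where "S = (\<Sum>k=1..p-1. ?f k)"
    \<comment> \<open>The quotient of \<open>S + 5/6 p\<close> by \<open>p^2\<close>; the last summand comes from
      \<open>10 p D_p D_(p-1) = 10 p (3 + p a) (1 + p b)\<close>.\<close>
    define z where "z = (18 * d p * d (p - 1) - 3 * (d p ^ 2 - d (p - 1) ^ 2)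
        - 10 * (of_nat a + 3 * of_nat b + P * of_nat a * of_nat b)) / of_nat 36"
    have "(\<Sum>k=1..p. ?f k) = S - P ^ 2 * d p * d (p - 1)"
      using sum.cl_ivl_Suc[of ?f 1 "p - 1"] p by (simp add: S_def P_def)
    moreover have "- 36 * (\<Sum>k=1..p. ?f k)
        = 3 * P ^ 2 * (d p ^ 2 - d (p - 1) ^ 2) + (18 * P ^ 2 + 10 * P) * d p * d (p - 1)"
      using sum_delannoy_products[of "p - 1", unfolded p(1) p(3)] p(2) unfolding d_def by simp
    ultimately have S: "36 * S = 36 * P ^ 2 * d p * d (p - 1)
        - (3 * P ^ 2 * (d p ^ 2 - d (p - 1) ^ 2) + (18 * P ^ 2 + 10 * P) * d p * d (p - 1))"
      by algebra
    have z: "36 * z = 18 * d p * d (p - 1) - 3 * (d p ^ 2 - d (p - 1) ^ 2)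
        - 10 * (of_nat a + 3 * of_nat b + P * of_nat a * of_nat b)"
      by (simp add: z_def)
    have "36 * S = - 30 * P + P ^ 2 * (36 * z)"
      unfolding S z using d by algebra
    hence "S = - (5 / 6) * P + P ^ 2 * z" by simp
    moreover have "z \<in> int_localization p"
      unfolding z_def d_def using assms(1) not_dvd' P_loc
      by (intro int_localization_divide_of_nat int_localization_intros)
    moreover have "- (5 / 6) * P \<in> int_localization p"
    proof -
      have "- 5 * P / of_nat 6 \<in> int_localization p"
        using assms(1) not_dvd' P_loc by (intro int_localization_divide_of_nat int_localization_intros)
      thus ?thesis by simp
    qed
    ultimately show ?thesis
      using local_congI[of p "- (5 / 6) * P" z S "p ^ 2"] assms(1)
      by (simp add: P_def S_def d_def)
  qed

  show "local_cong p (of_nat p ^ 2)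
           (\<Sum>k=1..p. (-1) ^ k * (4 * of_nat k ^ 2 + 2 * of_nat k - 1) *
              of_nat (central_delannoy (k - 1)) * little_schroeder k)
           (- 4 * of_nat p)"
  proof -
    define S where "S = (\<Sum>k=1..p. (-1) ^ k * (4 * of_nat k ^ 2 + 2 * of_nat k - 1)
        * d (k - 1) * little_schroeder k)"
    obtain v where v: "v \<in> int_localization p" "little_schroeder p = 2 + P * v"
      using little_schroeder_cong_prime[OF assms] by (auto simp: P_def)
    define B :: rat where "B = of_nat b"
    define s where "s = little_schroeder p"
    \<comment> \<open>The quotient of \<open>S + 4 p\<close> by \<open>p^2\<close>. After multiplication by \<open>-9\<close>, the first
      four summands are the quotient of
      \<open>2 D^2 + 9 D s + 4 s^2 - 36\<close> by \<open>p\<close> for \<open>D = 1 + p b\<close> and \<open>s = 2 + p v\<close>; the last two come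
      from the parts of the closed form that are divisible by \<open>p^2\<close>.\<close>
    define z where "z = - (4 * B + 2 * P * B ^ 2 + 9 * (v + 2 * B + P * B * v) + 4 * (4 * v + P * v ^ 2)
        + 18 * d (p - 1) * s + 4 * (2 + P) * s ^ 2) / of_nat 9"
    have S: "- 9 * S = 2 * P * d (p - 1) ^ 2 + 9 * P * (2 * P + 1) * d (p - 1) * s
        + 4 * P * (P + 1) ^ 2 * s ^ 2"
    proof -
      have q: "2 * of_nat (p - 1) + 3 = 2 * P + 1" "of_nat (p - 1) + 2 = P + 1"
        using p(3) by linarith+
      show ?thesis
        using sum_delannoy_schroeder_products[of "p - 1", unfolded p(1) p(3) q] p(2)
        unfolding d_def S_def s_def by simp
    qed
    have z: "9 * z = - (4 * B + 2 * P * B ^ 2 + 9 * (v + 2 * B + P * B * v) + 4 * (4 * v + P * v ^ 2)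
        + 18 * d (p - 1) * s + 4 * (2 + P) * s ^ 2)"
      by (simp add: z_def)
    have "9 * S = - 36 * P + P ^ 2 * (9 * z)"
      unfolding z using S d(2) v(2) unfolding s_def[symmetric] B_def[symmetric] by algebra
    hence "S = - 4 * P + P ^ 2 * z" by simp
    moreover have s_loc: "s \<in> int_localization p"
      using v P_loc assms(1) by (auto simp: s_def intro!: int_localization_intros)
    have "z \<in> int_localization p"
      unfolding z_def d_def B_def using assms(1) not_dvd' P_loc s_loc v(1)
      by (intro int_localization_divide_of_nat int_localization_intros)
    moreover have "- 4 * P \<in> int_localization p"
      using assms(1) P_loc by (intro int_localization_intros)
    ultimately show ?thesis
      using local_congI[of p "- 4 * P" z S "p ^ 2"] assms(1)
      by (simp add: P_def S_def d_def)
  qed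
qed

end
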